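(* Let $N, M \ge 1$ be integers with $N$ even, let $\bm{B} = (B_1,\dots,B_M)$ with $0 < B_j < \infty$, and let $Y_{ij}(\bm{W};\bm{B})$ and $\mathcal{Y}_{ij}(\bm{W};\mathcal{B}(K)\mid \bm{d})$ be the (fixed, non-random) potential outcomes of the original and of the proportionally restricted campaigns described in the context. Assume: (Limited interference) For all $i\in[N]$, $j\in[M]$, $1\le K\le N$, all $\bm{d}\in\{0,1\}^N$ with $\sum_i d_i = K$, and all $\bm{W}\in\{0,1\}^N$, the value $\mathcal{Y}_{ij}(\bm{W};\mathcal{B}(K)\mid\bm{d})$ depends on $\bm{W}$ only through the subvector $\bm{W}_{\bm{d}=1} = (W_{i'})_{i' : d_{i'}=1}$, i.e. $\mathcal{Y}_{ij}(\bm{W};\mathcal{B}(K)\mid\bm{d}) = \mathcal{Y}_{ij}(\bm{W}_{\bm{d}=1};\mathcal{B}(K)\mid\bm{d})$. (Stable system) For all $j\in[M]$ and $1\le K\le N$, $$\frac1N\sum_{i=1}^N Y_{ij}(\bm{1};\bm{B}) = \mathbb{E}_{\bm{d}}\Big[\frac1K\sum_{i=1}^N d_i\,\mathcal{Y}_{ij}(\bm{1}_K;\mathcal{B}(K)\mid\bm{d})\Big],\qquad \frac1N\sum_{i=1}^N Y_{ij}(\bm{0};\bm{B}) = \mathbb{E}_{\bm{d}}\Big[\frac1K\sum_{i=1}^N d_i\,\mathcal{Y}_{ij}(\bm{0}_K;\mathcal{B}(K)\mid\bm{d})\Big],$$ where $\bm{d}$ is uniformly distributed on $\{\bm{d}\in\{0,1\}^N:\sum_i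 d_i = K\}$. Consider the budget-split design with $N^{(0)} = N^{(1)} = N/2$ and $p = 0.5$: $\bm{d}$ is uniformly distributed on the vectors in $\{0,1\}^N$ with exactly $N^{(1)}$ ones, $\tilde W_1\sim\mathrm{Bernoulli}(p)$ is independent of $\bm{d}$, and $\tilde W_0 = 1-\tilde W_1$. Then for each $j\in[M]$ the budget-split estimator $$\hat\tau_j^{BS}(\bm{B}) = \sum_{l=0,1}\tilde W_l\sum_{i=1}^N\frac{\mathbb{1}(d_i=l)\,Y_{ij}^{(l)}(\bm{1}_{N^{(l)}};\bm{B}^{(l)}\mid\bm{d})}{N^{(l)}/N} - \sum_{l=0,1}(1-\tilde W_l)\sum_{i=1}^N\frac{\mathbb{1}(d_i=l)\,Y_{ij}^{(l)}(\bm{0}_{N^{(l)}};\bm{B}^{(l)}\mid\bm{d})}{N^{(l)}/N}$$ is unbiased for $\tau_j(\bm{B}) = \sum_{i=1}^N\big[Y_{ij}(\bm{1};\bm{B}) - Y_{ij}(\bm{0};\bm{B})\big]$, that is, $$\mathbb{E}_{\tilde W_1,\bm{d}}\big[\hat\tau_j^{BS}(\bm{B})\big] = \tau_j(\bm{B}).$$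
   Context: Setting. A marketplace has $N$ members, indexed by $i\in[N]=\{1,\dots,N\}$, and $M$ campaigns, indexed by $j\in[M]$. Campaign $j$ has budget $B_j$ and targets all members. For a treatment assignment $\bm{W}\in\{0,1\}^N$ of the members, $Y_{ij}(\bm{W};\bm{B})\ge 0$ is the potential outcome of the pair (member $i$, campaign $j$). All potential outcomes are fixed real numbers (arbitrary functions of their arguments); the only randomness comes from the design, i.e. from $\bm{d}$ and $\tilde W_1$. $\bm{1},\bm{0}$ denote the all-ones and all-zeros vectors of length $N$, and $\bm{1}_K,\bm{0}_K$ those of length $K$. Proportionally restricted campaigns. For $1\le K\le N$, all campaigns are restricted to target only a common set of $K$ members, chosen completely at random (uniformly among all $K$-subsets of $[N]$), and campaign $j$ is given budget $\mathcal{B}_j(K)=K B_j/N$. Write $\mathcal{B}(K) = (\mathcal{B}_1(K),\dots,\mathcal{B}_M(K))$, and let $\bm{d}\in\{0,1\}^N$ with $\sum_i d_i=K$ be the indicator vector of the chosen members. The potential outcomes of the restricted campaigns are real numbers $\mathcal{Y}_{ij}(\bm{W};\mathcal{B}(K)\mid\bm{d})$, with the convention that they equal $0$ if $d_i=0$. When they depend on $\bm{W}$ only through $\bm{W}_{\bm{d}=1}$, one writes $\mathcal{Y}_{ij}(\bm{w};\mathcal{B}(K)\mid\bm{d})$ for $\bm{w}\in\{0,1\}^K$ (the assignment of the $K$ chosen members). Budget-split design. The members are split at random into two buckets of sizes $N^{(0)}$ and $N^{(1)}=N-N^{(0)}$, with $d_i\in\{0,1\}$ the bucket of member $i$ (so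 $\sum_i d_i = N^{(1)}$). Each campaign $j$ is replaced by two campaigns, one for each bucket $l\in\{0,1\}$, that target only the members with $d_i=l$ and have budget $B_j^{(l)} = (N^{(l)}/N)B_j$; set $\bm{B}^{(l)} = (B_1^{(l)},\dots,B_M^{(l)})$, which equals $\mathcal{B}(N^{(l)})$. The members in bucket $l$ all receive treatment if $\tilde W_l=1$ and all receive control if $\tilde W_l=0$. The potential outcomes of the split campaigns are those of the corresponding proportionally restricted campaigns: for $\bm{w}\in\{0,1\}^{N^{(l)}}$, $$Y_{ij}^{(1)}(\bm{w};\bm{B}^{(1)}\mid\bm{d}) = \mathcal{Y}_{ij}(\bm{w};\mathcal{B}(N^{(1)})\mid\bm{d})\ \text{ if } d_i=1,\qquad Y_{ij}^{(0)}(\bm{w};\bm{B}^{(0)}\mid\bm{d}) = \mathcal{Y}_{ij}(\bm{w};\mathcal{B}(N^{(0)})\mid \bm{1}-\bm{d})\ \text{ if } d_i=0.$$ (The values of $Y_{ij}^{(l)}$ for $d_i\neq l$ are irrelevant, as they are multiplied by $\mathbb{1}(d_i=l)=0$.) *)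

theory Defs
  imports "HOL-Probability.Probability"
begin

(* Vectors in {0,1}^n are Boolean lists of length n (True = 1).  Members and campaigns are numbered
   from 0: i ranges over {..<N}, j over {..<M}.  A budget vector is a real list of length M. *)

type_synonym outcome = "nat \<Rightarrow> nat \<Rightarrow> bool list \<Rightarrow> real list \<Rightarrow> real"
type_synonym restricted_outcome = "nat \<Rightarrow> nat \<Rightarrow> bool list \<Rightarrow> real list \<Rightarrow> bool list \<Rightarrow> real"

definition bitvecs :: "nat \<Rightarrow> bool list set" where
  "bitvecs n = {W. length W = n}"

definition selections :: "nat \<Rightarrow> nat \<Rightarrow> bool list set" where
  "selections N K = {d \<in> bitvecs N. (\<Sum>i<N. of_bool (d ! i)) = K}"

(* the subvector of W formed by the entries at the positions i with d ! i = 1 *)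
definition subvec :: "bool list \<Rightarrow> bool list \<Rightarrow> bool list" where
  "subvec d W = nths W {i. i < length d \<and> d ! i}"

definition prop_budget :: "nat \<Rightarrow> real list \<Rightarrow> nat \<Rightarrow> real list" where
  "prop_budget N B K = map (\<lambda>b. real K * b / real N) B"

definition limited_interference ::
    "nat \<Rightarrow> nat \<Rightarrow> real list \<Rightarrow> restricted_outcome \<Rightarrow> bool" where
  "limited_interference N M B \<Y> \<longleftrightarrow>
     (\<forall>i<N. \<forall>j<M. \<forall>K\<in>{1..N}. \<forall>d\<in>selections N K. \<forall>W\<in>bitvecs N. \<forall>W'\<in>bitvecs N.
        subvec d W = subvec d W' \<longrightarrow>
        \<Y> i j W (prop_budget N B K) d = \<Y> i j W' (prop_budget N B K) d)"

(* The restricted outcome as a function of the assignment w of the selected members only: the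
   common value over all full assignments W extending w.  It is well defined under
   limited_interference. *)
definition sub_outcome :: "nat \<Rightarrow> restricted_outcome \<Rightarrow> restricted_outcome" where
  "sub_outcome N \<Y> i j w b d =
     (THE y. \<exists>W\<in>bitvecs N. subvec d W = w \<and> y = \<Y> i j W b d)"

definition stable_system ::
    "nat \<Rightarrow> nat \<Rightarrow> real list \<Rightarrow> outcome \<Rightarrow> restricted_outcome \<Rightarrow> bool" where
  "stable_system N M B Y \<Y> \<longleftrightarrow>
     (\<forall>j<M. \<forall>K\<in>{1..N}. \<forall>z.
        1 / real N * (\<Sum>i<N. Y i j (replicate N z) B) =
        measure_pmf.expectation (pmf_of_set (selections N K))
          (\<lambda>d. 1 / real K * (\<Sum>i<N. of_bool (d ! i) *
                 sub_outcome N \<Y> i j (replicate K z) (prop_budget N B K) d)))"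

definition total_effect :: "nat \<Rightarrow> real list \<Rightarrow> outcome \<Rightarrow> nat \<Rightarrow> real" where
  "total_effect N B Y j =
     (\<Sum>i<N. Y i j (replicate N True) B - Y i j (replicate N False) B)"

(* Budget-split design.  Buckets are indexed by l :: bool; N1 is the size of bucket 1. *)

definition bucket_size :: "nat \<Rightarrow> nat \<Rightarrow> bool \<Rightarrow> nat" where
  "bucket_size N N1 l = (if l then N1 else N - N1)"

definition bucket_budget :: "nat \<Rightarrow> nat \<Rightarrow> real list \<Rightarrow> bool \<Rightarrow> real list" where
  "bucket_budget N N1 B l = map (\<lambda>b. real (bucket_size N N1 l) / real N * b) B"

(* Ys l is the family of outcomes in bucket l; its values for members outside bucket l are
   unconstrained. *)
definition split_outcomes ::
    "nat \<Rightarrow> nat \<Rightarrow> nat \<Rightarrow> real list \<Rightarrow> restricted_outcome \<Rightarrow> (bool \<Rightarrow> restricted_outcome) \<Rightarrow> bool"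
where
  "split_outcomes N M N1 B \<Y> Ys \<longleftrightarrow>
     (\<forall>i<N. \<forall>j<M. \<forall>d\<in>selections N N1.
        (d ! i \<longrightarrow> (\<forall>w\<in>bitvecs (bucket_size N N1 True).
           Ys True i j w (bucket_budget N N1 B True) d =
           sub_outcome N \<Y> i j w (prop_budget N B (bucket_size N N1 True)) d)) \<and>
        (\<not> d ! i \<longrightarrow> (\<forall>w\<in>bitvecs (bucket_size N N1 False).
           Ys False i j w (bucket_budget N N1 B False) d =
           sub_outcome N \<Y> i j w (prop_budget N B (bucket_size N N1 False)) (map Not d))))"

(* joint law of the bucket vector d and the treatment of bucket 1 *)
definition split_design :: "nat \<Rightarrow> nat \<Rightarrow> real \<Rightarrow> (bool list \<times> bool) pmf" where
  "split_design N N1 p = pair_pmf (pmf_of_set (selections N N1)) (bernoulli_pmf p)"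

definition bucket_treatment :: "bool \<Rightarrow> bool \<Rightarrow> bool" where
  "bucket_treatment W1 l = (if l then W1 else \<not> W1)"

definition split_estimator ::
    "nat \<Rightarrow> nat \<Rightarrow> real list \<Rightarrow> (bool \<Rightarrow> restricted_outcome) \<Rightarrow> nat \<Rightarrow> bool list \<Rightarrow> bool \<Rightarrow> real"
where
  "split_estimator N N1 B Ys j d W1 =
     (\<Sum>l\<in>UNIV. of_bool (bucket_treatment W1 l) *
        (\<Sum>i<N. of_bool ((d ! i) = l) *
             Ys l i j (replicate (bucket_size N N1 l) True) (bucket_budget N N1 B l) d /
             (real (bucket_size N N1 l) / real N))) -
     (\<Sum>l\<in>UNIV. (1 - of_bool (bucket_treatment W1 l)) *
        (\<Sum>i<N. of_bool ((d ! i) = l) *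
             Ys l i j (replicate (bucket_size N N1 l) False) (bucket_budget N N1 B l) d /
             (real (bucket_size N N1 l) / real N)))"

end

theory Submission
  imports Defs
begin

text \<open>Complementation preserves the uniform law on bucket vectors of two equally large buckets, so
each bucket is distributed like a uniformly selected set of \<open>N / 2\<close> members.  Each bucket is treated
with probability \<open>1 / 2\<close>, and stability identifies the mean scaled outcome of a bucket, treated or not,
with the corresponding total outcome of the original marketplace.\<close>

lemma finite_selections: "finite (selections N K)"
proof -
  have "selections N K \<subseteq> {W. set W \<subseteq> UNIV \<and> length W = N}"
    by (auto simp: selections_def bitvecs_def)
  then show ?thesis
    by (rule finite_subset) (rule finite_lists_length_eq, simp)
qed

text \<open>Needed for \<open>pmf_of_set (selections N K)\<close> to be the uniform law. The witness
  selects the first \<open>K\<close> members.\<close>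

lemma selections_nonempty:
  assumes "K \<le> N"
  shows "selections N K \<noteq> {}"
proof -
  have "(\<Sum>i<N. of_bool (map (\<lambda>i. i < K) [0..<N] ! i)) = (\<Sum>i<N. of_bool (i < K) :: nat)"
    by (intro sum.cong) auto
  also have "\<dots> = card {i \<in> {..<N}. i < K}"
    by (simp add: of_bool_def sum.inter_filter [symmetric])
  also have "{i \<in> {..<N}. i < K} = {..<K}"
    using assms by auto
  finally have "map (\<lambda>i. i < K) [0..<N] \<in> selections N K"
    by (simp add: selections_def bitvecs_def del: sum_of_bool_eq)
  then show ?thesis by blast
qed

lemma map_Not_selections:
  assumes "d \<in> selections N K"
  shows "map Not d \<in> selections N (N - K)"
proof -
  have len: "length d = N" and sumd: "(\<Sum>i<N. of_bool (d ! i)) = K"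
    using assms by (auto simp: selections_def bitvecs_def)
  \<comment> \<open>Each position carries a 1 in exactly one of \<open>d\<close> and its complement.
    Adding \<open>K\<close> on the left keeps truncated subtraction out of the count.\<close>
  have "(\<Sum>i<N. of_bool (map Not d ! i)) + K = (\<Sum>i<N. of_bool (map Not d ! i) + of_bool (d ! i))"
    by (simp add: sumd sum.distrib)
  also have "\<dots> = (\<Sum>i<N. 1)"
    using len by (intro sum.cong) auto
  finally have "(\<Sum>i<N. of_bool (map Not d ! i)) = N - K"
    by simp
  then show ?thesis
    using len by (simp add: selections_def bitvecs_def del: sum_of_bool_eq)
qed

lemma bij_betw_map_Not_selections:
  assumes "K \<le> N"
  shows "bij_betw (map Not) (selections N K) (selections N (N - K))"
proof (rule bij_betw_byWitness[where f' = "map Not"])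
  show "map Not ` selections N K \<subseteq> selections N (N - K)"
    using map_Not_selections by blast
  show "map Not ` selections N (N - K) \<subseteq> selections N K"
    \<comment> \<open>The bound \<open>K \<le> N\<close> enters here: it gives
      \<open>N - (N - K) = K\<close> for natural numbers.\<close>
    using map_Not_selections[of _ N "N - K"] assms by (simp add: image_subset_iff)
qed (simp_all add: comp_def)

text \<open>A bijection between finite nonempty sets carries the uniform law to the uniform law.
  This brings bucket 0, whose indicator vector is \<open>map Not d\<close>, within reach of
  \<open>stable_system\<close>.\<close>

lemma expectation_selections_map_Not:
  fixes f :: "bool list \<Rightarrow> real"
  assumes "K \<le> N"
  shows "measure_pmf.expectation (pmf_of_set (selections N K)) (\<lambda>d. f (map Not d)) =
         measure_pmf.expectation (pmf_of_set (selections N (N - K))) f"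
proof -
  have "map_pmf (map Not) (pmf_of_set (selections N K)) = pmf_of_set (selections N (N - K))"
    using assms by (intro map_pmf_of_set_bij_betw bij_betw_map_Not_selections
      selections_nonempty finite_selections)
  then show ?thesis
    by (metis integral_map_pmf)
qed

text \<open>Integrates out the coin \<open>W1\<close>: by independence the joint mass factors, and
  all sums are finite.\<close>

lemma expectation_split_design:
  fixes f :: "bool list \<Rightarrow> bool \<Rightarrow> real"
  assumes "N1 \<le> N" and "0 \<le> p" and "p \<le> 1"
  shows "measure_pmf.expectation (split_design N N1 p) (\<lambda>(d, W1). f d W1) =
         measure_pmf.expectation (pmf_of_set (selections N N1))
           (\<lambda>d. p * f d True + (1 - p) * f d False)"
proof -
  let ?S = "selections N N1"
  have S: "?S \<noteq> {}" "finite ?S"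
    using assms selections_nonempty finite_selections by auto
  have "measure_pmf.expectation (split_design N N1 p) (\<lambda>(d, W1). f d W1) =
        (\<Sum>x\<in>?S \<times> UNIV. pmf (split_design N N1 p) x *\<^sub>R (\<lambda>(d, W1). f d W1) x)"
    using S by (intro integral_measure_pmf) (auto simp: split_design_def)
  also have "\<dots> = (\<Sum>d\<in>?S. pmf (pmf_of_set ?S) d *\<^sub>R (p * f d True + (1 - p) * f d False))"
    unfolding sum.cartesian_product'
    using assms by (simp add: split_design_def pmf_pair UNIV_bool algebra_simps)
  also have "\<dots> = measure_pmf.expectation (pmf_of_set ?S) (\<lambda>d. p * f d True + (1 - p) * f d False)"
    using S by (intro integral_measure_pmf [symmetric]) auto
  finally show ?thesis .
qed

lemma bucket_budget_eq_prop_budget: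
  "bucket_budget N N1 B l = prop_budget N B (bucket_size N N1 l)"
  by (simp add: bucket_budget_def prop_budget_def)

text \<open>The random variable whose expectation \<open>stable_system\<close> prescribes.\<close>

definition selected_mean ::
    "nat \<Rightarrow> real list \<Rightarrow> restricted_outcome \<Rightarrow> nat \<Rightarrow> nat \<Rightarrow> bool \<Rightarrow> bool list \<Rightarrow> real" where
  "selected_mean N B \<Y> j K z d =
     1 / real K * (\<Sum>i<N. of_bool (d ! i) *
       sub_outcome N \<Y> i j (replicate K z) (prop_budget N B K) d)"

text \<open>The equation holds member by member. Inside the bucket, \<open>split_outcomes\<close>
  applies; outside it, both indicators vanish, so the unconstrained values of \<open>Ys\<close> drop
  out. For an empty bucket both sides are 0, since division by zero yields 0.\<close>

lemma bucket_sum_eq_selected_mean: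
  assumes "split_outcomes N M N1 B \<Y> Ys" and j: "j < M" and d: "d \<in> selections N N1"
  shows "(\<Sum>i<N. of_bool ((d ! i) = l) *
            Ys l i j (replicate (bucket_size N N1 l) z) (bucket_budget N N1 B l) d /
            (real (bucket_size N N1 l) / real N)) =
         real N * selected_mean N B \<Y> j (bucket_size N N1 l) z (if l then d else map Not d)"
proof -
  let ?K = "bucket_size N N1 l" and ?d = "if l then d else map Not d"
  have len: "length d = N"
    using d by (simp add: selections_def bitvecs_def)
  have "of_bool ((d ! i) = l) * Ys l i j (replicate ?K z) (bucket_budget N N1 B l) d /
          (real ?K / real N) =
        real N * (1 / real ?K * (of_bool (?d ! i) *
          sub_outcome N \<Y> i j (replicate ?K z) (prop_budget N B ?K) ?d))"
    if "i < N" for i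
  proof (cases "(d ! i) = l")
    case True
    have "Ys l i j (replicate ?K z) (bucket_budget N N1 B l) d =
          sub_outcome N \<Y> i j (replicate ?K z) (prop_budget N B ?K) ?d"
    proof (cases l)
      case l: True
      then show ?thesis
        using assms(1)[unfolded split_outcomes_def, rule_format, OF that j d, THEN conjunct1] True
        by (simp add: bitvecs_def)
    next
      case l: False
      then show ?thesis
        using assms(1)[unfolded split_outcomes_def, rule_format, OF that j d, THEN conjunct2] True
        by (simp add: bitvecs_def)
    qed
    with True that len show ?thesis by simp
  next
    case False
    with that len show ?thesis by simp
  qed
  then show ?thesis
    unfolding selected_mean_def sum_distrib_left by (intro sum.cong) auto
qed

text \<open>The buckets receive opposite treatments, so each of the two sums in the estimator keeps
  exactly one bucket.\<close>

lemma split_estimator_eq_selected_mean: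
  assumes "split_outcomes N M N1 B \<Y> Ys" and "j < M" and "d \<in> selections N N1"
  shows "split_estimator N N1 B Ys j d W1 =
         real N * (if W1
           then selected_mean N B \<Y> j N1 True d - selected_mean N B \<Y> j (N - N1) False (map Not d)
           else selected_mean N B \<Y> j (N - N1) True (map Not d) - selected_mean N B \<Y> j N1 False d)"
  unfolding split_estimator_def bucket_sum_eq_selected_mean[OF assms]
  by (cases W1) (simp_all add: UNIV_bool bucket_treatment_def bucket_size_def right_diff_distrib)

theorem theorem1:
  fixes N M :: nat and B :: "real list"
    and Y :: outcome and \<Y> :: restricted_outcome and Ys :: "bool \<Rightarrow> restricted_outcome"
  assumes "N \<ge> 1" and "M \<ge> 1" and "even N"
    and "length B = M" and "\<And>j. j < M \<Longrightarrow> 0 < B ! j"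
    and nonneg: "\<And>i j W. i < N \<Longrightarrow> j < M \<Longrightarrow> W \<in> bitvecs N \<Longrightarrow> Y i j W B \<ge> 0"
    and unselected: "\<And>i j K d W. i < N \<Longrightarrow> j < M \<Longrightarrow> K \<in> {1..N} \<Longrightarrow> d \<in> selections N K \<Longrightarrow>
           W \<in> bitvecs N \<Longrightarrow> \<not> d ! i \<Longrightarrow> \<Y> i j W (prop_budget N B K) d = 0"
    and "limited_interference N M B \<Y>"
    and "stable_system N M B Y \<Y>"
    and "split_outcomes N M (N div 2) B \<Y> Ys"
  shows "\<forall>j<M. measure_pmf.expectation (split_design N (N div 2) (1 / 2))
                 (\<lambda>(d, W1). split_estimator N (N div 2) B Ys j d W1) = total_effect N B Y j"
proof (intro allI impI)
  fix j assume j: "j < M"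
  define h where "h = N div 2"
  \<comment> \<open>Evenness makes the buckets equally large, and with \<open>N \<ge> 1\<close> it
    makes them nonempty, as \<open>stable_system\<close> requires.\<close>
  have h: "h \<in> {1..N}" "h \<le> N" "N - h = h"
    using \<open>N \<ge> 1\<close> \<open>even N\<close> by (auto simp: h_def elim!: evenE)
  let ?P = "pmf_of_set (selections N h)"
  let ?E = "measure_pmf.expectation ?P"
  let ?G = "selected_mean N B \<Y> j h"
  have set_P: "set_pmf ?P = selections N h"
    using h by (simp add: selections_nonempty finite_selections)
  \<comment> \<open>Finite support gives the integrability behind the linearity used at the
    end.\<close>
  have int: "integrable (measure_pmf ?P) f" for f :: "bool list \<Rightarrow> real"
    by (rule integrable_measure_pmf_finite) (simp add: set_P finite_selections)
  have mean: "real N * ?E (?G z) = (\<Sum>i<N. Y i j (replicate N z) B)" for z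
  proof -
    have "1 / real N * (\<Sum>i<N. Y i j (replicate N z) B) = ?E (?G z)"
      using \<open>stable_system N M B Y \<Y>\<close> j h unfolding stable_system_def selected_mean_def by blast
    then show ?thesis
      using \<open>N \<ge> 1\<close> by (simp add: field_simps)
  qed
  \<comment> \<open>As \<open>N - h = h\<close>, the complement of \<open>d\<close> has the same law
    as \<open>d\<close>.\<close>
  have flip: "?E (\<lambda>d. ?G z (map Not d)) = ?E (?G z)" for z
    using expectation_selections_map_Not[of h N "?G z"] h by simp
  have "measure_pmf.expectation (split_design N h (1 / 2))
          (\<lambda>(d, W1). split_estimator N h B Ys j d W1) =
        ?E (\<lambda>d. 1 / 2 * split_estimator N h B Ys j d True +
          (1 - 1 / 2) * split_estimator N h B Ys j d False)"
    using h by (intro expectation_split_design) auto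
  \<comment> \<open>Over the two coin outcomes each bucket is treated once and in control once. The
    rewriting is valid only on the support of \<open>d\<close>, hence the almost-everywhere
    congruence.\<close>
  also have "\<dots> = ?E (\<lambda>d. real N / 2 *
      (?G True d + ?G True (map Not d) - ?G False d - ?G False (map Not d)))"
  proof (intro integral_cong_AE AE_pmfI)
    fix d assume "d \<in> set_pmf ?P"
    then have "d \<in> selections N h" by (simp add: set_P)
    from split_estimator_eq_selected_mean[OF
      \<open>split_outcomes N M (N div 2) B \<Y> Ys\<close>[folded h_def] j this]
    show "1 / 2 * split_estimator N h B Ys j d True +
        (1 - 1 / 2) * split_estimator N h B Ys j d False =
        real N / 2 * (?G True d + ?G True (map Not d) - ?G False d - ?G False (map Not d))"
      by (simp add: h(3) field_simps)
  qed auto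
  \<comment> \<open>By \<open>flip\<close> the two buckets contribute equally, which cancels the
    factor 1/2.\<close>
  also have "\<dots> = real N * ?E (?G True) - real N * ?E (?G False)"
    by (simp add: int flip algebra_simps)
  also have "\<dots> = total_effect N B Y j"
    by (simp add: mean total_effect_def sum_subtractf)
  finally show "measure_pmf.expectation (split_design N (N div 2) (1 / 2))
      (\<lambda>(d, W1). split_estimator N (N div 2) B Ys j d W1) = total_effect N B Y j"
    by (simp add: h_def)
qed

end
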